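(* Let $n$ and $k$ be integers with $\frac{n}{2} > k \geq 1$, and let $\Gamma = H(n,k)$ be the bipartite Kneser graph, with vertex partition $V = V_1 \cup V_2$, $V_1 \cap V_2 = \varnothing$, where $V_1 = \{v \mid v \subset [n],\ |v| = k\}$ and $V_2 = \{w \mid w \subset [n],\ |w| = n-k\}$. Then $\mathrm{Aut}(\Gamma) \cong \mathrm{Sym}([n]) \times \mathbb{Z}_2$.
   Context: For a positive integer $n$, $[n] = \{1, 2, \dots, n\}$. For integers $n > 2k$, $k \geq 1$, the bipartite Kneser graph $H(n,k)$ is the finite simple undirected graph whose vertices are all $k$-subsets and all $(n-k)$-subsets of $[n]$, two distinct vertices $A, B$ being adjacent if and only if $A \subset B$ or $B \subset A$. $\mathrm{Aut}(\Gamma)$ denotes the group of graph automorphisms of $\Gamma$ (bijections of the vertex set preserving adjacency and non-adjacency) under composition, $\mathrm{Sym}([n])$ is the group of all permutations of $[n]$, and $\mathbb{Z}_2$ is the cyclic group of order $2$. *)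

theory Defs
  imports
    "HOL-Algebra.Bij"
    "HOL-Algebra.Elementary_Groups"
    "HOL-Algebra.Sym_Groups"
    "Graph_Theory.Pair_Digraph"
begin

text \<open>A simple undirected graph is a \<^locale>\<open>pair_graph\<close>: a finite loop-free digraph whose arc
  relation is symmetric, so that an edge joining \<open>u\<close> and \<open>v\<close> is the pair of arcs \<open>(u, v)\<close>, \<open>(v, u)\<close>.\<close>

definition kneser_part :: "nat \<Rightarrow> nat \<Rightarrow> nat set set" where
  "kneser_part n j = {v. v \<subseteq> {1..n} \<and> card v = j}"

definition bipartite_kneser :: "nat \<Rightarrow> nat \<Rightarrow> nat set pair_pre_digraph" where
  "bipartite_kneser n k =
     (let V = kneser_part n k \<union> kneser_part n (n - k)
      in \<lparr>pverts = V, parcs = {(A, B). A \<in> V \<and> B \<in> V \<and> (A \<subset> B \<or> B \<subset> A)}\<rparr>)"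

text \<open>As in \<^const>\<open>Bij\<close>, automorphisms are extensional functions (fixed to \<open>undefined\<close> outside the
  vertex set), so that each vertex bijection is represented exactly once.\<close>

definition graph_auto :: "'a pair_pre_digraph \<Rightarrow> ('a \<Rightarrow> 'a) set" where
  "graph_auto G = {f \<in> Bij (pverts G).
     \<forall>u \<in> pverts G. \<forall>v \<in> pverts G. (f u, f v) \<in> parcs G \<longleftrightarrow> (u, v) \<in> parcs G}"

definition Aut :: "'a pair_pre_digraph \<Rightarrow> ('a \<Rightarrow> 'a) monoid" where
  "Aut G = BijGroup (pverts G) \<lparr>carrier := graph_auto G\<rparr>"

lemma kneser_parts_disjoint:
  assumes "2 * k < n"
  shows "kneser_part n k \<inter> kneser_part n (n - k) = {}"
  using assms by (auto simp: kneser_part_def)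

lemma pair_graph_bipartite_kneser: "pair_graph (bipartite_kneser n k)"
proof -
  let ?V = "kneser_part n k \<union> kneser_part n (n - k)"
  have fin: "finite ?V"
    by (rule finite_subset[of _ "Pow {1..n}"]) (auto simp: kneser_part_def)
  have "finite {(A, B). A \<in> ?V \<and> B \<in> ?V \<and> (A \<subset> B \<or> B \<subset> A)}"
    by (rule finite_subset[of _ "?V \<times> ?V"]) (use fin in auto)
  with fin show ?thesis
    by unfold_locales (auto simp: bipartite_kneser_def Let_def symmetric_def sym_def)
qed

lemma subgroup_graph_auto: "subgroup (graph_auto G) (BijGroup (pverts G))"
proof (rule subgroup.intro)
  show "graph_auto G \<subseteq> carrier (BijGroup (pverts G))"
    by (auto simp: graph_auto_def BijGroup_def)
next
  fix f g assume fg: "f \<in> graph_auto G" "g \<in> graph_auto G"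
  then have "f \<in> Bij (pverts G)" "g \<in> Bij (pverts G)" "g \<in> pverts G \<rightarrow> pverts G"
    by (auto simp: graph_auto_def dest: Bij_imp_funcset)
  with fg show "f \<otimes>\<^bsub>BijGroup (pverts G)\<^esub> g \<in> graph_auto G"
    by (simp add: graph_auto_def BijGroup_def compose_Bij Pi_iff compose_eq)
next
  show "\<one>\<^bsub>BijGroup (pverts G)\<^esub> \<in> graph_auto G"
    by (simp add: graph_auto_def BijGroup_def id_Bij)
next
  fix f assume f: "f \<in> graph_auto G"
  then have B: "f \<in> Bij (pverts G)" by (simp add: graph_auto_def)
  then have inv: "f (inv_into (pverts G) f x) = x" if "x \<in> pverts G" for x
    using that by (simp add: Bij_def bij_betw_def f_inv_into_f)
  have "(inv_into (pverts G) f u, inv_into (pverts G) f v) \<in> parcs G \<longleftrightarrow> (u, v) \<in> parcs G"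
    if "u \<in> pverts G" "v \<in> pverts G" for u v
  proof -
    have "inv_into (pverts G) f u \<in> pverts G" "inv_into (pverts G) f v \<in> pverts G"
      using B that by (auto intro: Bij_inv_into_mem)
    with f that inv show ?thesis by (force simp: graph_auto_def)
  qed
  with B show "inv\<^bsub>BijGroup (pverts G)\<^esub> f \<in> graph_auto G"
    by (simp add: inv_BijGroup graph_auto_def restrict_inv_into_Bij)
qed

lemma group_Aut: "group (Aut G)"
  unfolding Aut_def by (rule subgroup.subgroup_is_group[OF subgroup_graph_auto group_BijGroup])

end

theory Submission
  imports Defs
begin

text \<open>
  A permutation of \<open>{1..n}\<close> acts on the vertices of the bipartite Kneser graph by taking images, and
  complementation exchanges the two sides. Both are automorphisms and they commute, so together they
  give a homomorphism \<open>kneser_action\<close> from the direct product into the automorphism group. It is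
  injective because the \<open>k\<close>-subsets separate points and because complementation changes the size of a
  vertex. The work lies in surjectivity.

  Two \<open>k\<close>-sets that differ in one element have at most \<open>k + 1 \<le> n - k\<close> points in their union, so they
  have a common neighbour and an automorphism sends them to the same side. As any two \<open>k\<close>-sets are
  linked by such exchanges, an automorphism preserves the two sides or exchanges them, and composing
  with complementation reduces to the first case (\<open>graph_auto_same_side\<close>).

  An automorphism that preserves the sides is a pair of bijections, of the \<open>k\<close>-sets and of the
  \<open>(n - k)\<close>-sets, that respects inclusion. The aim is to recover the points of \<open>{1..n}\<close> from the
  inclusion relation between these two levels, which is done in two moves.

  \<^item> Upwards: a set of at most \<open>n - k\<close> points is the intersection of the \<open>(n - k)\<close>-sets above it.
    Hence for \<open>k\<close>-sets \<open>A\<close> and \<open>B\<close> the family of \<open>k\<close>-subsets of \<open>A \<union> B\<close> is expressed by inclusions, and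
    its cardinality tells whether \<open>A \<union> B\<close> has \<open>k + 1\<close> elements. So the bijection of the \<open>k\<close>-sets
    induces one of the \<open>(k + 1)\<close>-sets (\<open>incidence_auto_up\<close>).

  \<^item> Downwards: inclusions between two consecutive levels \<open>j + 1\<close> and \<open>j + 2\<close> determine when three
    distinct \<open>(j + 1)\<close>-sets, any two of which lie in a common \<open>(j + 2)\<close>-set, share a common \<open>j\<close>-set: this
    is so exactly when the three do not lie in a common \<open>(j + 2)\<close>-set. A \<open>j\<close>-set is thus
    recovered from the family of \<open>(j + 1)\<close>-sets above it, and the bijection induces one of the
    \<open>j\<close>-sets (\<open>incidence_auto_down\<close>).

  Descending from the levels \<open>k\<close> and \<open>k + 1\<close> to the singletons yields a permutation, and since a set is
  the union of its subsets of any smaller positive size, this permutation induces the given bijections on all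
  levels that were passed, and then on the \<open>(n - k)\<close>-sets (\<open>incidence_auto_lift\<close>).
\<close>

section \<open>Maps of two levels that preserve inclusion\<close>

lemma kneser_partD:
  assumes "A \<in> kneser_part n j"
  shows "finite A" "A \<subseteq> {1..n}" "card A = j"
  using assms by (auto simp: kneser_part_def intro: finite_subset)

lemma finite_kneser_part: "finite (kneser_part n j)"
  by (rule finite_subset[of _ "Pow {1..n}"]) (auto simp: kneser_part_def)

lemma two_distinct_elements:
  assumes "2 \<le> card S"
  obtains a b where "a \<in> S" "b \<in> S" "a \<noteq> b"
  using obtain_subset_with_card_n[OF assms] by (metis card_2_iff insert_subset)

lemma kneser_part_subset_eq:
  "\<lbrakk>A \<in> kneser_part n j; B \<in> kneser_part n j; A \<subseteq> B\<rbrakk> \<Longrightarrow> A = B"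
  by (metis card_subset_eq kneser_partD(1,3))

lemma ex_kneser_part_below:
  assumes "S \<subseteq> {1..n}" "x \<in> S" "1 \<le> j" "j \<le> card S"
  shows "\<exists>C \<in> kneser_part n j. x \<in> C \<and> C \<subseteq> S"
proof -
  have "finite S" using assms(1) finite_subset by blast
  then obtain C where "{x} \<subseteq> C" "C \<subseteq> S" "card C = j"
    using exists_subset_between[of "{x}" j S] assms by auto
  then show ?thesis using assms(1) by (auto simp: kneser_part_def)
qed

lemma ex_kneser_part_above:
  assumes "S \<subseteq> {1..n}" "x \<notin> S" "card S \<le> m" "m < n"
  shows "\<exists>W \<in> kneser_part n m. S \<subseteq> W \<and> x \<notin> W"
proof -
  have "m \<le> card ({1..n} - {x})" using assms(4) by (cases "x \<in> {1..n}") auto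
  then obtain W where "S \<subseteq> W" "W \<subseteq> {1..n} - {x}" "card W = m"
    using exists_subset_between[of S m "{1..n} - {x}"] assms by auto
  then show ?thesis by (auto simp: kneser_part_def)
qed

definition incidence_auto :: "nat \<Rightarrow> nat \<Rightarrow> nat \<Rightarrow> (nat set \<Rightarrow> nat set) \<Rightarrow> (nat set \<Rightarrow> nat set) \<Rightarrow> bool" where
  "incidence_auto n j m f g \<longleftrightarrow>
     bij_betw f (kneser_part n j) (kneser_part n j) \<and>
     bij_betw g (kneser_part n m) (kneser_part n m) \<and>
     (\<forall>A \<in> kneser_part n j. \<forall>W \<in> kneser_part n m. f A \<subseteq> g W \<longleftrightarrow> A \<subseteq> W)"

lemma bij_betw_kneser_part:
  assumes "h \<in> kneser_part n j \<rightarrow> kneser_part n j" "inj_on h (kneser_part n j)"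
  shows "bij_betw h (kneser_part n j) (kneser_part n j)"
  using assms by (simp add: bij_betw_def endo_inj_surj finite_kneser_part image_subset_iff_funcset)

text \<open>
  It is enough to find the image of each \<open>m\<close>-set separately: distinct sets get distinct images because
  a set is the union of its \<open>j\<close>-subsets, and an injective self-map of a finite level is bijective.
\<close>

lemma ex_incidence_auto_above:
  assumes f: "bij_betw f (kneser_part n j) (kneser_part n j)" and jm: "1 \<le> j" "j \<le> m"
    and ex: "\<And>T. T \<in> kneser_part n m \<Longrightarrow>
      \<exists>T' \<in> kneser_part n m. \<forall>C \<in> kneser_part n j. f C \<subseteq> T' \<longleftrightarrow> C \<subseteq> T"
  shows "\<exists>h. incidence_auto n j m f h"
proof -
  obtain h where h: "\<And>T. T \<in> kneser_part n m \<Longrightarrow> h T \<in> kneser_part n m"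
    "\<And>T C. \<lbrakk>T \<in> kneser_part n m; C \<in> kneser_part n j\<rbrakk> \<Longrightarrow> f C \<subseteq> h T \<longleftrightarrow> C \<subseteq> T"
    using ex by metis
  have le: "T \<subseteq> S" if "T \<in> kneser_part n m" "S \<in> kneser_part n m" "h T = h S" for T S
  proof
    fix x assume "x \<in> T"
    then obtain C where "C \<in> kneser_part n j" "x \<in> C" "C \<subseteq> T"
      using ex_kneser_part_below[of T n x j] jm kneser_partD[OF \<open>T \<in> kneser_part n m\<close>] by blast
    then show "x \<in> S" using h(2) that by blast
  qed
  have "inj_on h (kneser_part n m)"
    using le by (intro inj_onI subset_antisym) auto
  then have "bij_betw h (kneser_part n m) (kneser_part n m)"
    using h(1) by (intro bij_betw_kneser_part) auto
  then show ?thesis using f h(2) unfolding incidence_auto_def by blast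
qed

text \<open>
  The dual principle, in which a set is recovered as the intersection of the \<open>m\<close>-sets above it.
  The bound \<open>m < n\<close> is strict because for \<open>m = n\<close> that intersection is always the ground set.
\<close>

lemma ex_incidence_auto_below:
  assumes f: "bij_betw f (kneser_part n m) (kneser_part n m)" and jm: "j \<le> m" "m < n"
    and ex: "\<And>S. S \<in> kneser_part n j \<Longrightarrow>
      \<exists>S' \<in> kneser_part n j. \<forall>C \<in> kneser_part n m. S' \<subseteq> f C \<longleftrightarrow> S \<subseteq> C"
  shows "\<exists>h. incidence_auto n j m h f"
proof -
  obtain h where h: "\<And>S. S \<in> kneser_part n j \<Longrightarrow> h S \<in> kneser_part n j"
    "\<And>S C. \<lbrakk>S \<in> kneser_part n j; C \<in> kneser_part n m\<rbrakk> \<Longrightarrow> h S \<subseteq> f C \<longleftrightarrow> S \<subseteq> C"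
    using ex by metis
  have le: "S \<subseteq> T" if "T \<in> kneser_part n j" "S \<in> kneser_part n j" "h T = h S" for T S
  proof (rule ccontr)
    assume "\<not> S \<subseteq> T"
    then obtain x where x: "x \<in> S" "x \<notin> T" by blast
    then obtain W where "W \<in> kneser_part n m" "x \<notin> W" "T \<subseteq> W"
      using ex_kneser_part_above[of T n x m] jm kneser_partD[OF \<open>T \<in> kneser_part n j\<close>] by blast
    then show False using h(2) that x by blast
  qed
  have "inj_on h (kneser_part n j)"
    using le by (intro inj_onI subset_antisym) auto
  then have "bij_betw h (kneser_part n j) (kneser_part n j)"
    using h(1) by (intro bij_betw_kneser_part) auto
  then show ?thesis using f h(2) unfolding incidence_auto_def by blast
qed

section \<open>The level above, by Galois closure\<close>

text \<open>
  A set of \<open>k + 1\<close> elements has exactly \<open>k + 1\<close> subsets of size \<open>k\<close>; with this bound, the number of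
  \<open>k\<close>-subsets excludes every larger cardinality.
\<close>

lemma card_k_subsets_large:
  assumes U: "U \<subseteq> {1..n}" and k: "1 \<le> k" "k + 2 \<le> card U"
  shows "k + 1 < card {C \<in> kneser_part n k. C \<subseteq> U}"
proof -
  obtain U' where U': "U' \<subseteq> U" "card U' = k + 1" "finite U'"
    using obtain_subset_with_card_n[of "k+1" U] k by auto
  then obtain x where x: "x \<in> U" "x \<notin> U'" using k by (metis Suc_n_not_le_n add_2_eq_Suc' subset_antisym subsetI Suc_eq_plus1)
  obtain C where C: "C \<in> kneser_part n k" "x \<in> C" "C \<subseteq> U"
    using ex_kneser_part_below[OF U x(1), of k] k by auto
  have "k + 1 = card {C. C \<subseteq> U' \<and> card C = k}"
    using n_subsets[OF U'(3), of k] U'(2) by simp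
  also have "\<dots> < card {C \<in> kneser_part n k. C \<subseteq> U}"
  proof (rule psubset_card_mono)
    show "finite {C \<in> kneser_part n k. C \<subseteq> U}" using finite_kneser_part by simp
    show "{C. C \<subseteq> U' \<and> card C = k} \<subset> {C \<in> kneser_part n k. C \<subseteq> U}"
      using U U'(1) C x(2) by (auto simp: kneser_part_def)
  qed
  finally show ?thesis .
qed

text \<open>
  Write a \<open>(k + 1)\<close>-set \<open>T\<close> as \<open>A \<union> B\<close> with \<open>k\<close>-sets \<open>A\<close> and \<open>B\<close>; its image should be
  \<open>U = f A \<union> f B\<close>. The \<open>k\<close>-subsets of \<open>T\<close> are those contained in every \<open>m\<close>-set above \<open>A\<close> and \<open>B\<close>, a
  property that \<open>f\<close> and \<open>g\<close> transport to \<open>U\<close>. So \<open>f\<close> matches the \<open>k\<close>-subsets of \<open>T\<close> with those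
  of \<open>U\<close>, and counting them gives \<open>card U = k + 1\<close>.
\<close>

lemma incidence_auto_up:
  assumes fg: "incidence_auto n k m f g" and k: "1 \<le> k" and km: "k < m" and mn: "m < n"
  shows "\<exists>h. incidence_auto n k (k + 1) f h"
proof (rule ex_incidence_auto_above)
  show bf: "bij_betw f (kneser_part n k) (kneser_part n k)"
    using fg by (simp add: incidence_auto_def)
  have bg: "g ` kneser_part n m = kneser_part n m"
    and inc: "\<And>A W. \<lbrakk>A \<in> kneser_part n k; W \<in> kneser_part n m\<rbrakk> \<Longrightarrow> f A \<subseteq> g W \<longleftrightarrow> A \<subseteq> W"
    using fg by (auto simp: incidence_auto_def bij_betw_def)
  have fK: "f C \<in> kneser_part n k" if "C \<in> kneser_part n k" for C
    using bf that bij_betwE by blast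
  fix T assume T: "T \<in> kneser_part n (k + 1)"
  note T' = kneser_partD[OF T]
  have "2 \<le> card T" using T' k by simp
  then obtain a b where ab: "a \<in> T" "b \<in> T" "a \<noteq> b"
    using two_distinct_elements by blast
  define A B where "A = T - {a}" and "B = T - {b}"
  have AB: "A \<in> kneser_part n k" "B \<in> kneser_part n k" "A \<union> B = T" "A \<noteq> B"
    using ab T' by (auto simp: A_def B_def kneser_part_def)
  define U where "U = f A \<union> f B"
  have U: "U \<subseteq> {1..n}" "finite U"
    using fK AB kneser_partD unfolding U_def by blast+
  have closure: "C \<subseteq> T \<longleftrightarrow> (\<forall>W \<in> kneser_part n m. U \<subseteq> W \<longrightarrow> f C \<subseteq> W)"
    if C: "C \<in> kneser_part n k" for C
  proof -
    have "C \<subseteq> T \<longleftrightarrow> (\<forall>W \<in> kneser_part n m. T \<subseteq> W \<longrightarrow> C \<subseteq> W)"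
      using ex_kneser_part_above[OF T'(2) _ _ mn] T'(3) km by (metis Suc_eq_plus1 Suc_leI subsetD subsetI subset_trans)
    also have "\<dots> \<longleftrightarrow> (\<forall>W \<in> kneser_part n m. U \<subseteq> g W \<longrightarrow> f C \<subseteq> g W)"
      using inc AB C unfolding U_def by (metis Un_subset_iff)
    also have "\<dots> \<longleftrightarrow> (\<forall>W \<in> g ` kneser_part n m. U \<subseteq> W \<longrightarrow> f C \<subseteq> W)" by blast
    finally show ?thesis unfolding bg .
  qed
  \<comment> \<open>Otherwise no \<open>m\<close>-set lies above \<open>U\<close>, and the closure would contain every \<open>k\<close>-set.\<close>
  have Um: "card U \<le> m"
  proof (rule ccontr)
    assume "\<not> card U \<le> m"
    then have *: "\<not> U \<subseteq> W" if "W \<in> kneser_part n m" for W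
      using kneser_partD[OF that] card_mono by blast
    have "card T < card {1..n}" using T'(3) km mn by simp
    then obtain x where x: "x \<in> {1..n}" "x \<notin> T" using T'(1)
      by (metis card_mono linorder_not_le subsetI)
    obtain C where "C \<in> kneser_part n k" "x \<in> C"
      using ex_kneser_part_below[of "{1..n}" n x k] x k km mn by auto
    then show False using closure * x by blast
  qed
  have fU: "f C \<subseteq> U \<longleftrightarrow> C \<subseteq> T" if C: "C \<in> kneser_part n k" for C
    unfolding closure[OF C] using ex_kneser_part_above[OF U(1) _ Um mn] by (metis subsetD subsetI subset_trans)
  have "f ` {C \<in> kneser_part n k. C \<subseteq> T} = {C \<in> kneser_part n k. C \<subseteq> U}"
  proof -
    have "f ` {C \<in> kneser_part n k. f C \<subseteq> U} = {C \<in> f ` kneser_part n k. C \<subseteq> U}" by blast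
    then show ?thesis using fU bf by (simp add: bij_betw_def cong: conj_cong)
  qed
  moreover have "inj_on f {C \<in> kneser_part n k. C \<subseteq> T}"
    using bf by (auto simp: bij_betw_def intro: inj_on_subset)
  ultimately have "card {C \<in> kneser_part n k. C \<subseteq> U} = card {C \<in> kneser_part n k. C \<subseteq> T}"
    using card_image by fastforce
  also have "{C \<in> kneser_part n k. C \<subseteq> T} = {C. C \<subseteq> T \<and> card C = k}"
    using T' by (auto simp: kneser_part_def)
  also have "card \<dots> = k + 1" using n_subsets[OF T'(1), of k] T'(3) by simp
  finally have "card U < k + 2" using card_k_subsets_large[OF U(1) k] by linarith
  moreover have "card U \<noteq> k"
  proof
    assume "card U = k"
    then have "U \<in> kneser_part n k" using U by (simp add: kneser_part_def)
    then have "f A = U" "f B = U"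
      using kneser_part_subset_eq fK AB unfolding U_def by blast+
    then show False using AB bf by (metis bij_betw_def inj_onD)
  qed
  moreover have "k \<le> card U" using kneser_partD(3)[OF fK[OF AB(1)]] U(2) card_mono[of U "f A"]
    by (simp add: U_def)
  ultimately have "card U = k + 1" by linarith
  then have "U \<in> kneser_part n (k + 1)" using U by (simp add: kneser_part_def)
  then show "\<exists>T' \<in> kneser_part n (k + 1). \<forall>C \<in> kneser_part n k. f C \<subseteq> T' \<longleftrightarrow> C \<subseteq> T"
    using fU by blast
qed (use k in auto)

section \<open>The level below, by stars\<close>

text \<open>
  Since only membership in a common \<open>m\<close>-set is transported by an incidence-preserving pair, adjacency
  of two sets and coplanarity of three are both phrased through this one relation; two sets
  are handled by repeating an argument.
\<close>

definition joined :: "nat \<Rightarrow> nat \<Rightarrow> nat set \<Rightarrow> nat set \<Rightarrow> nat set \<Rightarrow> bool" where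
  "joined n m A B C \<longleftrightarrow> (\<exists>T \<in> kneser_part n m. A \<subseteq> T \<and> B \<subseteq> T \<and> C \<subseteq> T)"

lemma joined_iff:
  assumes "A \<subseteq> {1..n}" "B \<subseteq> {1..n}" "C \<subseteq> {1..n}" "m \<le> n"
  shows "joined n m A B C \<longleftrightarrow> card (A \<union> B \<union> C) \<le> m"
proof
  assume "joined n m A B C"
  then obtain T where "T \<in> kneser_part n m" "A \<union> B \<union> C \<subseteq> T" by (auto simp: joined_def)
  then show "card (A \<union> B \<union> C) \<le> m" using kneser_partD card_mono by metis
next
  assume "card (A \<union> B \<union> C) \<le> m"
  then obtain T where "A \<union> B \<union> C \<subseteq> T" "T \<subseteq> {1..n}" "card T = m"
    using exists_subset_between[of "A \<union> B \<union> C" m "{1..n}"] assms by auto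
  then show "joined n m A B C" by (auto simp: joined_def kneser_part_def)
qed

lemma joined_incidence_auto:
  assumes "incidence_auto n j m f g" "A \<in> kneser_part n j" "B \<in> kneser_part n j" "C \<in> kneser_part n j"
  shows "joined n m (f A) (f B) (f C) \<longleftrightarrow> joined n m A B C"
proof -
  have "g ` kneser_part n m = kneser_part n m"
    using assms(1) by (auto simp: incidence_auto_def bij_betw_def)
  then have "joined n m (f A) (f B) (f C) \<longleftrightarrow>
      (\<exists>T \<in> g ` kneser_part n m. f A \<subseteq> T \<and> f B \<subseteq> T \<and> f C \<subseteq> T)"
    unfolding joined_def by simp
  also have "\<dots> \<longleftrightarrow> (\<exists>T \<in> kneser_part n m. f A \<subseteq> g T \<and> f B \<subseteq> g T \<and> f C \<subseteq> g T)"
    by blast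
  also have "\<dots> \<longleftrightarrow> joined n m A B C"
    unfolding joined_def using assms by (simp add: incidence_auto_def cong: bex_cong)
  finally show ?thesis .
qed

text \<open>
  Let \<open>A\<close> and \<open>B\<close> be distinct \<open>(j + 1)\<close>-sets meeting in a \<open>j\<close>-set, so that \<open>A \<union> B\<close> has \<open>j + 2\<close>
  elements; two \<open>(j + 1)\<close>-sets lie in a common \<open>(j + 2)\<close>-set when they meet in at least \<open>j\<close> points.
  If \<open>C\<close> is not contained in \<open>A \<union> B\<close>, it has a point outside, and the remaining \<open>j\<close> points
  of \<open>C\<close> are too few to meet \<open>A\<close> and \<open>B\<close> in \<open>j\<close> points each unless they form \<open>A \<inter> B\<close>. Conversely, a
  \<open>(j + 1)\<close>-set between \<open>A \<inter> B\<close> and \<open>A \<union> B\<close> can only be \<open>A\<close> or \<open>B\<close>.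
\<close>

lemma star_iff_joined:
  assumes A: "A \<in> kneser_part n (j + 1)" and B: "B \<in> kneser_part n (j + 1)"
    and C: "C \<in> kneser_part n (j + 1)"
    and S: "card (A \<inter> B) = j" and j: "j + 2 \<le> n"
  shows "A \<inter> B \<subseteq> C \<longleftrightarrow> C = A \<or> C = B \<or>
    (joined n (j + 2) A A C \<and> joined n (j + 2) B B C \<and> \<not> joined n (j + 2) A B C)"
proof -
  note a = kneser_partD[OF A] and b = kneser_partD[OF B] and c = kneser_partD[OF C]
  have cAC: "card (A \<union> C) + card (A \<inter> C) = 2 * j + 2" "card (B \<union> C) + card (B \<inter> C) = 2 * j + 2"
    "card (A \<union> B) = j + 2"
    using card_Un_Int[OF a(1) c(1)] card_Un_Int[OF b(1) c(1)] card_Un_Int[OF a(1) b(1)] a b c S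
    by auto
  have J: "joined n (j + 2) A A C \<longleftrightarrow> j \<le> card (A \<inter> C)" "joined n (j + 2) B B C \<longleftrightarrow> j \<le> card (B \<inter> C)"
    using cAC a(2) b(2) c(2) j by (auto simp: joined_iff)
  have JJ: "joined n (j + 2) A B C \<longleftrightarrow> C \<subseteq> A \<union> B"
  proof -
    have "joined n (j + 2) A B C \<longleftrightarrow> card (A \<union> B \<union> C) \<le> card (A \<union> B)"
      using cAC a(2) b(2) c(2) j by (simp add: joined_iff)
    also have "\<dots> \<longleftrightarrow> C \<subseteq> A \<union> B"
      using card_seteq[of "A \<union> B \<union> C" "A \<union> B"] a(1) b(1) c(1) by (auto simp: Un_absorb2)
    finally show ?thesis .
  qed
  show ?thesis
  proof
    assume sub: "A \<inter> B \<subseteq> C"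
    show "C = A \<or> C = B \<or> (joined n (j + 2) A A C \<and> joined n (j + 2) B B C \<and> \<not> joined n (j + 2) A B C)"
    proof (cases "C = A \<or> C = B")
      case False
      have le: "j \<le> card (A \<inter> C)" "j \<le> card (B \<inter> C)"
        using card_mono[of "A \<inter> C" "A \<inter> B"] card_mono[of "B \<inter> C" "A \<inter> B"] sub a(1) b(1) S by auto
      have "\<not> C \<subseteq> A \<union> B"
      proof
        assume CAB: "C \<subseteq> A \<union> B"
        have "card (C - A \<inter> B) = 1" using sub S c by (simp add: card_Diff_subset finite_subset)
        then obtain x where x: "C - A \<inter> B = {x}" using card_1_singletonE by blast
        then have "C = insert x (A \<inter> B)" "x \<in> A \<or> x \<in> B" using sub CAB by auto
        then have "C \<subseteq> A \<or> C \<subseteq> B" by auto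
        then show False using kneser_part_subset_eq[OF C A] kneser_part_subset_eq[OF C B] False by auto
      qed
      then show ?thesis using le J JJ by simp
    qed auto
  next
    assume "C = A \<or> C = B \<or> (joined n (j + 2) A A C \<and> joined n (j + 2) B B C \<and> \<not> joined n (j + 2) A B C)"
    then consider "C = A" | "C = B" | "j \<le> card (A \<inter> C)" "j \<le> card (B \<inter> C)" "\<not> C \<subseteq> A \<union> B"
      using J JJ by blast
    then show "A \<inter> B \<subseteq> C"
    proof cases
      case 3
      then obtain x where x: "x \<in> C" "x \<notin> A" "x \<notin> B" by blast
      have cx: "card (C - {x}) = j" using x c by simp
      have "A \<inter> C = C - {x}"
        using x 3(1) cx c(1) by (intro card_seteq) auto
      moreover have "B \<inter> C = C - {x}"
        using x 3(2) cx c(1) by (intro card_seteq) auto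
      ultimately have "C - {x} \<subseteq> A \<inter> B" by blast
      then have "C - {x} = A \<inter> B" using cx S a(1) by (intro card_subset_eq) auto
      then show ?thesis by blast
    qed auto
  qed
qed

text \<open>
  The image of a \<open>j\<close>-set \<open>S = A \<inter> B\<close> should be \<open>f A \<inter> f B\<close>. The previous characterisation expresses
  the star of \<open>S\<close>, the family of \<open>(j + 1)\<close>-sets above it, through \<open>joined\<close>, so \<open>f\<close> carries it to
  the star of \<open>f A \<inter> f B\<close>.
\<close>

lemma incidence_auto_down:
  assumes fg: "incidence_auto n (j + 1) (j + 2) f g" and j: "j + 2 \<le> n"
  shows "\<exists>h. incidence_auto n j (j + 1) h f"
proof (rule ex_incidence_auto_below)
  show bf: "bij_betw f (kneser_part n (j + 1)) (kneser_part n (j + 1))"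
    using fg by (simp add: incidence_auto_def)
  have fK: "f C \<in> kneser_part n (j + 1)" if "C \<in> kneser_part n (j + 1)" for C
    using bf that bij_betwE by blast
  have f_eq: "f A = f B \<longleftrightarrow> A = B" if "A \<in> kneser_part n (j + 1)" "B \<in> kneser_part n (j + 1)" for A B
    using bf that by (auto simp: bij_betw_def inj_on_def)
  fix S assume S: "S \<in> kneser_part n j"
  note S' = kneser_partD[OF S]
  have "2 \<le> card ({1..n} - S)" using S' j by (simp add: card_Diff_subset)
  then obtain a b where ab: "a \<in> {1..n} - S" "b \<in> {1..n} - S" "a \<noteq> b"
    using two_distinct_elements by blast
  define A B where "A = insert a S" and "B = insert b S"
  have AB: "A \<in> kneser_part n (j + 1)" "B \<in> kneser_part n (j + 1)" "A \<inter> B = S" "A \<noteq> B"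
    using ab S' by (auto simp: A_def B_def kneser_part_def)
  note fA = kneser_partD[OF fK[OF AB(1)]] and fB = kneser_partD[OF fK[OF AB(2)]]
  have "card (A \<union> B) = j + 2"
    using card_Un_Int[of A B] AB kneser_partD[OF AB(1)] kneser_partD[OF AB(2)] S' by simp
  then have "joined n (j + 2) A A B"
    using joined_iff[of A n A B] kneser_partD[OF AB(1)] kneser_partD[OF AB(2)] j by simp
  then have "joined n (j + 2) (f A) (f A) (f B)"
    using joined_incidence_auto[OF fg] AB by simp
  then have "card (f A \<union> f B) \<le> j + 2"
    using joined_iff[of "f A" n "f A" "f B"] fA fB j by simp
  then have "j \<le> card (f A \<inter> f B)" using card_Un_Int[OF fA(1) fB(1)] fA fB by simp
  moreover have "card (f A \<inter> f B) < j + 1"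
  proof -
    have "\<not> f A \<subseteq> f B" using AB f_eq fK kneser_part_subset_eq by metis
    then have "f A \<inter> f B \<subset> f A" by blast
    then show ?thesis using psubset_card_mono[OF fA(1)] fA(3) by metis
  qed
  ultimately have c: "card (f A \<inter> f B) = j" by simp
  have "f A \<inter> f B \<subseteq> f C \<longleftrightarrow> S \<subseteq> C" if C: "C \<in> kneser_part n (j + 1)" for C
    using star_iff_joined[OF fK[OF AB(1)] fK[OF AB(2)] fK[OF C] c j]
      star_iff_joined[OF AB(1,2) C _ j] AB S'(3) C f_eq joined_incidence_auto[OF fg] by simp
  moreover have "f A \<inter> f B \<in> kneser_part n j" using c fA by (auto simp: kneser_part_def)
  ultimately show "\<exists>S' \<in> kneser_part n j. \<forall>C \<in> kneser_part n (j + 1). S' \<subseteq> f C \<longleftrightarrow> S \<subseteq> C"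
    by blast
qed (use j in auto)

section \<open>Incidence automorphisms come from permutations\<close>

text \<open>
  Every \<open>W\<close> of the upper level is the union of its \<open>j\<close>-subsets \<open>A\<close>, and each \<open>\<sigma> ` A\<close> lies in \<open>g W\<close>;
  equality follows by comparing cardinalities.
\<close>

lemma incidence_auto_lift:
  assumes fg: "incidence_auto n j m f g" and jm: "1 \<le> j" "j \<le> m"
    and \<sigma>: "\<sigma> permutes {1..n}" and f: "\<And>A. A \<in> kneser_part n j \<Longrightarrow> f A = \<sigma> ` A"
    and W: "W \<in> kneser_part n m"
  shows "g W = \<sigma> ` W"
proof -
  note w = kneser_partD[OF W]
  have gW: "g W \<in> kneser_part n m" using fg W by (auto simp: incidence_auto_def bij_betw_def)
  have "\<sigma> ` W \<subseteq> g W"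
  proof (rule image_subsetI)
    fix x assume "x \<in> W"
    then obtain A where "A \<in> kneser_part n j" "x \<in> A" "A \<subseteq> W"
      using ex_kneser_part_below[OF w(2)] jm w(3) by metis
    then show "\<sigma> x \<in> g W" using f fg W by (fastforce simp: incidence_auto_def)
  qed
  moreover have "card (\<sigma> ` W) = m" using w(3) \<sigma> by (metis card_image inj_on_subset permutes_inj subset_UNIV)
  ultimately show ?thesis using kneser_partD[OF gW] by (metis card_subset_eq)
qed

text \<open>
  By induction on \<open>k\<close>: a bijection of the singletons is a permutation of the points, and in the step the
  bijection induced one level below comes from a permutation, which lifts back to \<open>f\<close>.
\<close>

lemma incidence_auto_permutation:
  assumes "incidence_auto n k (k + 1) f g" "1 \<le> k" "k + 1 \<le> n"
  shows "\<exists>\<sigma>. \<sigma> permutes {1..n} \<and> (\<forall>A \<in> kneser_part n k. f A = \<sigma> ` A)"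
  using assms(2,1,3)
proof (induction k arbitrary: f g rule: dec_induct)
  case base
  have K1: "kneser_part n 1 = (\<lambda>x. {x}) ` {1..n}"
    by (auto simp: kneser_part_def card_1_singleton_iff)
  have bf: "bij_betw f (kneser_part n 1) (kneser_part n 1)"
    using base by (simp add: incidence_auto_def)
  have "\<exists>y \<in> {1..n}. f {x} = {y}" if "x \<in> {1..n}" for x
    using bij_betwE[OF bf] that unfolding K1 by blast
  then obtain s where s: "\<And>x. x \<in> {1..n} \<Longrightarrow> s x \<in> {1..n}" "\<And>x. x \<in> {1..n} \<Longrightarrow> f {x} = {s x}"
    by metis
  define \<sigma> where "\<sigma> x = (if x \<in> {1..n} then s x else x)" for x
  have "inj_on \<sigma> {1..n}"
  proof (rule inj_onI)
    fix x y assume xy: "x \<in> {1..n}" "y \<in> {1..n}" "\<sigma> x = \<sigma> y"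
    then have "f {x} = f {y}" using s(2) by (simp add: \<sigma>_def)
    moreover have "{x} \<in> kneser_part n 1" "{y} \<in> kneser_part n 1" using xy K1 by auto
    ultimately have "{x} = {y}" using bf by (meson bij_betw_def inj_onD)
    then show "x = y" by simp
  qed
  then have "bij_betw \<sigma> {1..n} {1..n}"
    using s(1) by (intro bij_betw_imageI endo_inj_surj) (auto simp: \<sigma>_def)
  then have "\<sigma> permutes {1..n}" by (rule bij_imp_permutes) (simp only: \<sigma>_def if_False)
  moreover have "\<forall>A \<in> kneser_part n 1. f A = \<sigma> ` A" unfolding K1 using s(2) by (simp add: \<sigma>_def)
  ultimately show ?case by blast
next
  case (step k)
  then obtain h where h: "incidence_auto n k (k + 1) h f"
    using incidence_auto_down[of n k f g] by auto
  then obtain \<sigma> where \<sigma>: "\<sigma> permutes {1..n}" "\<And>A. A \<in> kneser_part n k \<Longrightarrow> h A = \<sigma> ` A"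
    using step.IH[OF h] step.prems(2) by auto
  have "f A = \<sigma> ` A" if "A \<in> kneser_part n (k + 1)" for A
    using incidence_auto_lift[OF h _ _ \<sigma>] step.hyps that by simp
  then show ?case using \<sigma>(1) by auto
qed

lemma incidence_auto_two_levels:
  assumes fg: "incidence_auto n k m f g" and "1 \<le> k" "k < m" "m < n"
  shows "\<exists>\<sigma>. \<sigma> permutes {1..n} \<and> (\<forall>A \<in> kneser_part n k. f A = \<sigma> ` A) \<and>
    (\<forall>W \<in> kneser_part n m. g W = \<sigma> ` W)"
proof -
  obtain h where "incidence_auto n k (k + 1) f h" using incidence_auto_up[OF assms] by blast
  then obtain \<sigma> where \<sigma>: "\<sigma> permutes {1..n}" "\<And>A. A \<in> kneser_part n k \<Longrightarrow> f A = \<sigma> ` A"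
    using incidence_auto_permutation assms by (metis Suc_eq_plus1 Suc_leI less_trans)
  then have "g W = \<sigma> ` W" if "W \<in> kneser_part n m" for W
    using incidence_auto_lift[OF fg _ _ \<sigma> that] assms by simp
  then show ?thesis using \<sigma> by blast
qed

section \<open>Automorphisms preserve or exchange the two sides\<close>

lemma pverts_bipartite_kneser:
  "pverts (bipartite_kneser n k) = kneser_part n k \<union> kneser_part n (n - k)"
  by (simp add: bipartite_kneser_def Let_def)

lemma parcs_bipartite_kneser:
  assumes "A \<in> pverts (bipartite_kneser n k)" "B \<in> pverts (bipartite_kneser n k)"
  shows "(A, B) \<in> parcs (bipartite_kneser n k) \<longleftrightarrow> A \<subset> B \<or> B \<subset> A"
  using assms by (simp add: bipartite_kneser_def Let_def)

lemma kneser_parts_not_both: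
  "\<lbrakk>2 * k < n; A \<in> kneser_part n k; A \<in> kneser_part n (n - k)\<rbrakk> \<Longrightarrow> False"
  by (auto simp: kneser_part_def)

lemma kneser_part_psubset_card:
  "\<lbrakk>A \<in> kneser_part n i; B \<in> kneser_part n j; A \<subset> B\<rbrakk> \<Longrightarrow> i < j"
  using psubset_card_mono kneser_partD by metis

lemma graph_auto_bipartite_kneserD:
  assumes "f \<in> graph_auto (bipartite_kneser n k)"
  defines "V \<equiv> kneser_part n k \<union> kneser_part n (n - k)"
  shows "f \<in> extensional V" "bij_betw f V V"
    and "\<And>A B. \<lbrakk>A \<in> V; B \<in> V\<rbrakk> \<Longrightarrow> (f A \<subset> f B \<or> f B \<subset> f A) \<longleftrightarrow> (A \<subset> B \<or> B \<subset> A)"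
proof -
  show "f \<in> extensional V" and bij: "bij_betw f V V"
    using assms by (auto simp: graph_auto_def Bij_def pverts_bipartite_kneser)
  show "(f A \<subset> f B \<or> f B \<subset> f A) \<longleftrightarrow> (A \<subset> B \<or> B \<subset> A)" if "A \<in> V" "B \<in> V" for A B
  proof -
    have "f A \<in> V" "f B \<in> V" using bij that bij_betwE by blast+
    then show ?thesis
      using assms that parcs_bipartite_kneser[of A n k B] parcs_bipartite_kneser[of "f A" n k "f B"]
      by (simp add: graph_auto_def pverts_bipartite_kneser)
  qed
qed

lemma graph_auto_neighbour_sides:
  assumes f: "f \<in> graph_auto (bipartite_kneser n k)" and nk: "2 * k < n"
    and A: "A \<in> kneser_part n k" and W: "W \<in> kneser_part n (n - k)" and AW: "A \<subseteq> W"
  shows "f A \<in> kneser_part n k \<longleftrightarrow> f W \<in> kneser_part n (n - k)"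
proof -
  have "A \<subset> W" using AW kneser_parts_not_both[OF nk] A W by blast
  then have "f A \<subset> f W \<or> f W \<subset> f A"
    using graph_auto_bipartite_kneserD(3)[OF f, of A W] A W by blast
  moreover have "f A \<in> kneser_part n k \<union> kneser_part n (n - k)" "f W \<in> kneser_part n k \<union> kneser_part n (n - k)"
    using bij_betwE[OF graph_auto_bipartite_kneserD(2)[OF f]] A W by blast+
  ultimately show ?thesis
    using kneser_part_psubset_card nk kneser_parts_not_both[OF nk] by (metis Un_iff less_irrefl)
qed

text \<open>
  Induction on the number of elements of \<open>A\<close> outside \<open>B\<close>. Exchanging one of them for an element \<open>y\<close> of \<open>B\<close>
  gives \<open>A'\<close>. Since \<open>insert y A\<close> has \<open>k + 1 \<le> n - k\<close> elements, it lies in some \<open>(n - k)\<close>-set, which is a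
  common neighbour of \<open>A\<close> and \<open>A'\<close>.
\<close>

lemma graph_auto_same_side:
  assumes f: "f \<in> graph_auto (bipartite_kneser n k)" and nk: "2 * k < n"
    and A: "A \<in> kneser_part n k" and B: "B \<in> kneser_part n k"
  shows "f A \<in> kneser_part n k \<longleftrightarrow> f B \<in> kneser_part n k"
  using A
proof (induction "card (A - B)" arbitrary: A rule: less_induct)
  case less
  note a = kneser_partD[OF less.prems] and b = kneser_partD[OF B]
  show ?case
  proof (cases "A = B")
    case False
    then obtain x where x: "x \<in> A" "x \<notin> B" using kneser_part_subset_eq[OF less.prems B] by blast
    obtain y where y: "y \<in> B" "y \<notin> A" using kneser_part_subset_eq[OF B less.prems] False by blast
    define A' where "A' = insert y (A - {x})"
    have A': "A' \<in> kneser_part n k"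
      using a b x y card_Suc_Diff1[OF a(1) x(1)] unfolding A'_def kneser_part_def by auto
    have "A' - B \<subset> A - B" using x y by (auto simp: A'_def)
    then have IH: "f A' \<in> kneser_part n k \<longleftrightarrow> f B \<in> kneser_part n k"
      using less.hyps A' a(1) psubset_card_mono by (metis finite_Diff)
    have "card (insert y A) \<le> n - k" "insert y A \<subseteq> {1..n}" using a b y nk by auto
    then obtain W where W: "insert y A \<subseteq> W" "W \<in> kneser_part n (n - k)"
      using exists_subset_between[of "insert y A" "n - k" "{1..n}"] by (auto simp: kneser_part_def)
    then have "A \<subseteq> W" "A' \<subseteq> W" by (auto simp: A'_def)
    then show ?thesis
      using graph_auto_neighbour_sides[OF f nk _ W(2)] less.prems A' IH by blast
  qed simp
qed

lemma incidence_auto_of_graph_auto: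
  assumes f: "f \<in> graph_auto (bipartite_kneser n k)" and k: "1 \<le> k" and nk: "2 * k < n"
    and fK: "\<And>A. A \<in> kneser_part n k \<Longrightarrow> f A \<in> kneser_part n k"
  shows "incidence_auto n k (n - k) f f"
proof -
  note D = graph_auto_bipartite_kneserD[OF f]
  have fW: "f W \<in> kneser_part n (n - k)" if W: "W \<in> kneser_part n (n - k)" for W
  proof -
    note w = kneser_partD[OF W]
    have "W \<noteq> {}" using w nk by auto
    then obtain x where "x \<in> W" by blast
    moreover have "k \<le> card W" using w(3) nk by simp
    ultimately obtain A where "A \<in> kneser_part n k" "A \<subseteq> W"
      using ex_kneser_part_below[OF w(2)] k by blast
    then show ?thesis using graph_auto_neighbour_sides[OF f nk _ W] fK by blast
  qed
  have inj: "inj_on f (kneser_part n k)" "inj_on f (kneser_part n (n - k))"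
    using D(2) by (auto simp: bij_betw_def intro: inj_on_subset)
  have "f A \<subseteq> f W \<longleftrightarrow> A \<subseteq> W" if "A \<in> kneser_part n k" "W \<in> kneser_part n (n - k)" for A W
  proof -
    have "\<not> W \<subseteq> A" "\<not> f W \<subseteq> f A"
      using that fK fW kneser_partD nk card_mono
      by (metis diff_le_self le_diff_conv less_le_not_le mult_2 add.commute le_add_diff_inverse)+
    then show ?thesis using D(3)[of A W] that by blast
  qed
  then show ?thesis
    using bij_betw_kneser_part fK fW inj by (auto simp: incidence_auto_def)
qed

section \<open>The action of permutations and complementation\<close>

text \<open>
  The integer is a residue modulo 2 that decides whether the complement is taken. Restricting to the
  vertex set makes the maps extensional, as elements of \<^const>\<open>Aut\<close> have to be.
\<close>

definition kneser_action :: "nat \<Rightarrow> nat \<Rightarrow> (nat \<Rightarrow> nat) \<times> int \<Rightarrow> nat set \<Rightarrow> nat set" where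
  "kneser_action n k = (\<lambda>(\<sigma>, i). restrict (\<lambda>A. if i = 0 then \<sigma> ` A else {1..n} - \<sigma> ` A)
     (kneser_part n k \<union> kneser_part n (n - k)))"

lemma image_mem_kneser_part:
  assumes "\<sigma> permutes {1..n}" "A \<in> kneser_part n j"
  shows "\<sigma> ` A \<in> kneser_part n j"
  using assms permutes_image[OF assms(1)] card_image[OF inj_on_subset[OF permutes_inj[OF assms(1)]], of A]
  by (auto simp: kneser_part_def)

lemma compl_mem_kneser_part:
  assumes "A \<in> kneser_part n j"
  shows "{1..n} - A \<in> kneser_part n (n - j)"
  using kneser_partD[OF assms] by (auto simp: kneser_part_def card_Diff_subset)

lemma compl_mem_kneser_part':
  assumes "A \<in> kneser_part n (n - j)" "j \<le> n"
  shows "{1..n} - A \<in> kneser_part n j"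
  using compl_mem_kneser_part[OF assms(1)] assms(2) by simp

lemma kneser_action_graph_auto:
  assumes \<sigma>: "\<sigma> permutes {1..n}" and kn: "k \<le> n"
  shows "kneser_action n k (\<sigma>, i) \<in> graph_auto (bipartite_kneser n k)"
proof -
  define V where "V = kneser_part n k \<union> kneser_part n (n - k)"
  define f where "f = kneser_action n k (\<sigma>, i)"
  have f: "f A = (if i = 0 then \<sigma> ` A else {1..n} - \<sigma> ` A)" if "A \<in> V" for A
    using that by (simp add: f_def kneser_action_def V_def)
  have fV: "f A \<in> V" if "A \<in> V" for A
    unfolding f[OF that] using that image_mem_kneser_part[OF \<sigma>] compl_mem_kneser_part compl_mem_kneser_part'[OF _ kn]
    by (auto simp: V_def)
  have sub: "\<sigma> ` A \<subseteq> {1..n}" if "A \<in> V" for A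
    using that image_mem_kneser_part[OF \<sigma>] kneser_partD(2) unfolding V_def by blast
  have inj: "inj \<sigma>" using \<sigma> permutes_inj by blast
  have le: "\<sigma> ` A \<subseteq> \<sigma> ` B \<longleftrightarrow> A \<subseteq> B" for A B using inj inj_image_subset_iff by metis
  have mono: "f A \<subseteq> f B \<longleftrightarrow> (if i = 0 then A \<subseteq> B else B \<subseteq> A)" if "A \<in> V" "B \<in> V" for A B
  proof -
    have "{1..n} - \<sigma> ` A \<subseteq> {1..n} - \<sigma> ` B \<longleftrightarrow> \<sigma> ` B \<subseteq> \<sigma> ` A"
      using sub[OF that(1)] sub[OF that(2)] by blast
    then show ?thesis using f that le by simp
  qed
  have "inj_on f V"
  proof (rule inj_onI)
    fix A B assume "A \<in> V" "B \<in> V" "f A = f B"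
    then show "A = B" using mono[of A B] mono[of B A] by (auto split: if_splits)
  qed
  moreover have "finite V" by (simp add: V_def finite_kneser_part)
  ultimately have "bij_betw f V V" using fV by (intro bij_betw_imageI endo_inj_surj) auto
  moreover have "f \<in> extensional V" by (simp add: f_def kneser_action_def V_def)
  moreover have "(f A \<subset> f B \<or> f B \<subset> f A) \<longleftrightarrow> (A \<subset> B \<or> B \<subset> A)" if "A \<in> V" "B \<in> V" for A B
    using mono[OF that] mono[OF that(2,1)] by (simp add: less_le_not_le) blast
  ultimately have "f \<in> graph_auto (bipartite_kneser n k)"
    using fV by (simp add: graph_auto_def Bij_def pverts_bipartite_kneser parcs_bipartite_kneser V_def)
  then show ?thesis by (simp add: f_def)
qed

lemma mult_Aut:
  assumes "f \<in> graph_auto G" "g \<in> graph_auto G"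
  shows "f \<otimes>\<^bsub>Aut G\<^esub> g = compose (pverts G) f g"
  using assms by (simp add: Aut_def BijGroup_def graph_auto_def)

lemma carrier_Aut: "carrier (Aut G) = graph_auto G"
  by (simp add: Aut_def)

text \<open>
  Image under a permutation of \<open>{1..n}\<close> commutes with complementation, and complementing twice
  returns the set; this is why the second components add modulo 2.
\<close>

lemma kneser_action_mult:
  assumes \<sigma>: "\<sigma> permutes {1..n}" and \<tau>: "\<tau> permutes {1..n}" and kn: "k \<le> n"
    and ij: "i \<in> {0..<2}" "j \<in> {0..<2}"
  shows "kneser_action n k (\<sigma> \<circ> \<tau>, (i + j) mod 2) =
    kneser_action n k (\<sigma>, i) \<otimes>\<^bsub>Aut (bipartite_kneser n k)\<^esub> kneser_action n k (\<tau>, j)"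
proof -
  let ?V = "kneser_part n k \<union> kneser_part n (n - k)"
  have "kneser_action n k (\<sigma> \<circ> \<tau>, (i + j) mod 2) A =
      compose ?V (kneser_action n k (\<sigma>, i)) (kneser_action n k (\<tau>, j)) A" for A
  proof (cases "A \<in> ?V")
    case True
    have "kneser_action n k (\<tau>, j) A \<in> ?V"
      using bij_betwE[OF graph_auto_bipartite_kneserD(2)[OF kneser_action_graph_auto[OF \<tau> kn]]] True by blast
    moreover have sub: "\<tau> ` A \<subseteq> {1..n}" "\<sigma> ` \<tau> ` A \<subseteq> {1..n}"
      using True image_mem_kneser_part \<sigma> \<tau> kneser_partD(2) by (metis Un_iff)+
    moreover have "\<sigma> ` ({1..n} - B) = {1..n} - \<sigma> ` B" if "B \<subseteq> {1..n}" for B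
      using image_set_diff[OF permutes_inj[OF \<sigma>]] permutes_image[OF \<sigma>] by metis
    moreover have "i = 0 \<or> i = 1" "j = 0 \<or> j = 1" using ij by auto
    ultimately show ?thesis
      using True by (auto simp: kneser_action_def compose_def image_comp double_diff)
  qed (simp_all add: kneser_action_def compose_def)
  then show ?thesis
    using mult_Aut[OF kneser_action_graph_auto[OF \<sigma> kn] kneser_action_graph_auto[OF \<tau> kn]]
    by (auto simp: pverts_bipartite_kneser)
qed

text \<open>
  If \<open>\<sigma> x = \<tau> y\<close> with \<open>y \<noteq> x\<close>, a \<open>k\<close>-set that contains \<open>x\<close> but not \<open>y\<close> tells the two permutations apart.
\<close>

lemma permutation_eqI_kneser_part:
  assumes \<sigma>: "\<sigma> permutes {1..n}" and \<tau>: "\<tau> permutes {1..n}" and k: "1 \<le> k" "k < n"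
    and eq: "\<And>A. A \<in> kneser_part n k \<Longrightarrow> \<sigma> ` A = \<tau> ` A"
  shows "\<sigma> = \<tau>"
proof (rule ext)
  fix x
  show "\<sigma> x = \<tau> x"
  proof (cases "x \<in> {1..n}")
    case True
    show ?thesis
    proof (rule ccontr)
      assume ne: "\<sigma> x \<noteq> \<tau> x"
      define y where "y = inv_into UNIV \<tau> (\<sigma> x)"
      have y: "\<tau> y = \<sigma> x" using \<tau> by (simp add: y_def permutes_inverses)
      then have "x \<noteq> y" using ne by auto
      then obtain A where "A \<in> kneser_part n k" "x \<in> A" "y \<notin> A"
        using ex_kneser_part_above[of "{x}" n y k] True k by auto
      then show False using eq[of A] y permutes_inj[OF \<tau>] by (metis imageI inj_image_mem_iff)
    qed
  next
    case False
    then show ?thesis using \<sigma> \<tau> by (simp add: permutes_not_in)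
  qed
qed

lemma kneser_action_inj:
  assumes k: "1 \<le> k" "2 * k < n"
  shows "inj_on (kneser_action n k) ({p. p permutes {1..n}} \<times> {0..<2})"
proof (rule inj_onI, clarify)
  fix \<sigma> \<tau> and i j :: int
  assume \<sigma>: "\<sigma> permutes {1..n}" and \<tau>: "\<tau> permutes {1..n}"
    and ij: "i \<in> {0..<2}" "j \<in> {0..<2}"
    and eq: "kneser_action n k (\<sigma>, i) = kneser_action n k (\<tau>, j)"
  have eqA: "(if i = 0 then \<sigma> ` A else {1..n} - \<sigma> ` A) = (if j = 0 then \<tau> ` A else {1..n} - \<tau> ` A)"
    if "A \<in> kneser_part n k" for A
    using fun_cong[OF eq, of A] that by (simp add: kneser_action_def)
  have side: "(if i = 0 then \<sigma> ` A else {1..n} - \<sigma> ` A) \<in> kneser_part n k \<longleftrightarrow> i = 0"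
    if "A \<in> kneser_part n k" "\<sigma> permutes {1..n}" for A \<sigma> and i :: int
    using image_mem_kneser_part[OF that(2,1)] compl_mem_kneser_part kneser_parts_not_both[OF k(2)] by auto
  obtain A where A: "A \<in> kneser_part n k"
    using ex_kneser_part_below[of "{1..n}" n 1 k] k by auto
  have "i = 0 \<longleftrightarrow> j = 0" using side[OF A \<sigma>, of i] side[OF A \<tau>, of j] eqA[OF A] by simp
  then have "i = j" using ij by auto
  moreover have "\<sigma> ` A = \<tau> ` A" if A: "A \<in> kneser_part n k" for A
  proof -
    have "\<sigma> ` A \<subseteq> {1..n}" "\<tau> ` A \<subseteq> {1..n}"
      using image_mem_kneser_part A \<sigma> \<tau> kneser_partD(2) by blast+
    then have "\<sigma> ` A = \<tau> ` A" if "{1..n} - \<sigma> ` A = {1..n} - \<tau> ` A" using that by blast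
    then show ?thesis using eqA[OF A] \<open>i = j\<close> by (simp split: if_splits)
  qed
  then have "\<sigma> = \<tau>" using permutation_eqI_kneser_part[OF \<sigma> \<tau>] k by simp
  ultimately show "\<sigma> = \<tau> \<and> i = j" by simp
qed

lemma graph_auto_fixing_sides:
  assumes f: "f \<in> graph_auto (bipartite_kneser n k)" and k: "1 \<le> k" "2 * k < n"
    and fK: "\<And>A. A \<in> kneser_part n k \<Longrightarrow> f A \<in> kneser_part n k"
  shows "\<exists>\<sigma>. \<sigma> permutes {1..n} \<and> (\<forall>A \<in> kneser_part n k \<union> kneser_part n (n - k). f A = \<sigma> ` A)"
proof -
  have "k < n - k" "n - k < n" using k by auto
  from incidence_auto_two_levels[OF incidence_auto_of_graph_auto[OF f k fK] k(1) this]
  show ?thesis by (simp add: ball_Un)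
qed

text \<open>
  An automorphism that moves one \<open>k\<close>-set to the other side exchanges the sides; composed with
  complementation, it preserves them and comes from a permutation.
\<close>

lemma kneser_action_surj:
  assumes f: "f \<in> graph_auto (bipartite_kneser n k)" and k: "1 \<le> k" "2 * k < n"
  shows "f \<in> kneser_action n k ` ({p. p permutes {1..n}} \<times> {0..<2})"
proof -
  let ?V = "kneser_part n k \<union> kneser_part n (n - k)"
  note D = graph_auto_bipartite_kneserD[OF f]
  obtain A0 where A0: "A0 \<in> kneser_part n k"
    using ex_kneser_part_below[of "{1..n}" n 1 k] k by auto
  have "\<exists>\<sigma> i. \<sigma> permutes {1..n} \<and> i \<in> {0..<2} \<and> (\<forall>A \<in> ?V. f A = kneser_action n k (\<sigma>, i) A)"
  proof (cases "f A0 \<in> kneser_part n k")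
    case True
    then have "\<And>A. A \<in> kneser_part n k \<Longrightarrow> f A \<in> kneser_part n k"
      using graph_auto_same_side[OF f k(2) A0] by simp
    from graph_auto_fixing_sides[OF f k this]
    obtain \<sigma> where "\<sigma> permutes {1..n}" "\<And>A. A \<in> ?V \<Longrightarrow> f A = \<sigma> ` A" by blast
    then show ?thesis by (intro exI[of _ \<sigma>] exI[of _ 0]) (simp add: kneser_action_def)
  next
    case False
    define c where "c = kneser_action n k (id, 1)"
    define f' where "f' = c \<otimes>\<^bsub>Aut (bipartite_kneser n k)\<^esub> f"
    have c: "c \<in> graph_auto (bipartite_kneser n k)"
      unfolding c_def using k by (intro kneser_action_graph_auto permutes_id) auto
    have f': "f' \<in> graph_auto (bipartite_kneser n k)"
      using group.subgroup_self[OF group_Aut, THEN subgroup.m_closed] c f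
      unfolding f'_def carrier_Aut by blast
    have fV: "f A \<in> ?V" if "A \<in> ?V" for A using bij_betwE[OF D(2)] that by blast
    have f'_eq: "f' A = {1..n} - f A" if "A \<in> ?V" for A
      unfolding f'_def mult_Aut[OF c f] using that fV[OF that]
      by (simp add: pverts_bipartite_kneser compose_def c_def kneser_action_def)
    have "f' A \<in> kneser_part n k" if A: "A \<in> kneser_part n k" for A
    proof -
      have "f A \<in> kneser_part n (n - k)"
        using False graph_auto_same_side[OF f k(2) A0 A] fV A by blast
      then show ?thesis using f'_eq A compl_mem_kneser_part' k by simp
    qed
    from graph_auto_fixing_sides[OF f' k this]
    obtain \<sigma> where \<sigma>: "\<sigma> permutes {1..n}" "\<And>A. A \<in> ?V \<Longrightarrow> f' A = \<sigma> ` A" by blast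
    have "f A = {1..n} - \<sigma> ` A" if A: "A \<in> ?V" for A
    proof -
      have "f A \<subseteq> {1..n}" using fV[OF A] kneser_partD(2) by blast
      then have "f A = {1..n} - f' A" using f'_eq[OF A] by blast
      then show ?thesis using \<sigma>(2)[OF A] by simp
    qed
    then show ?thesis using \<sigma>(1) by (intro exI[of _ \<sigma>] exI[of _ 1]) (simp add: kneser_action_def)
  qed
  then obtain \<sigma> i where *: "\<sigma> permutes {1..n}" "i \<in> {0..<2}" "\<And>A. A \<in> ?V \<Longrightarrow> f A = kneser_action n k (\<sigma>, i) A"
    by blast
  have "f = kneser_action n k (\<sigma>, i)"
    using D(1) *(3) by (intro extensionalityI[where A = ?V]) (auto simp: kneser_action_def)
  then show ?thesis using *(1,2) by blast
qed

theorem theorem3p6: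
  fixes n k :: nat
  assumes "real n / 2 > real k" and "k \<ge> 1"
  shows "Aut (bipartite_kneser n k) \<cong> sym_group n \<times>\<times> integer_mod_group 2"
proof -
  let ?G = "sym_group n \<times>\<times> integer_mod_group 2"
  have k: "1 \<le> k" "2 * k < n" "k \<le> n" using assms by linarith+
  have carrier: "carrier ?G = {p. p permutes {1..n}} \<times> {0..<2}"
    by (simp add: sym_group_def carrier_integer_mod_group)
  have "kneser_action n k \<in> iso ?G (Aut (bipartite_kneser n k))"
  proof (rule isoI)
    show "kneser_action n k \<in> hom ?G (Aut (bipartite_kneser n k))"
      unfolding hom_def carrier carrier_Aut
      using kneser_action_graph_auto[OF _ k(3)] kneser_action_mult[OF _ _ k(3)]
      by (auto simp: sym_group_mult)
    show "bij_betw (kneser_action n k) (carrier ?G) (carrier (Aut (bipartite_kneser n k)))"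
      unfolding bij_betw_def carrier carrier_Aut
      using kneser_action_inj[OF k(1,2)] kneser_action_surj[OF _ k(1,2)] kneser_action_graph_auto[OF _ k(3)]
      by auto
  qed
  then show ?thesis
    using group.iso_sym[OF DirProd_group[OF sym_group_is_group group_integer_mod_group]] is_isoI by blast
qed

end
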